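(* Let $\mathcal{H}$ be a complex Hilbert space, let $A\in\mathcal{B}(\mathcal{H})$ be positive (semi-definite), let $\mathbb{A}=\begin{pmatrix}A&0\\0&A\end{pmatrix}$, and let $P,Q\in\mathcal{B}_{A}(\mathcal{H})$. Then $$\omega_{\mathbb{A}}\left[\begin{pmatrix}P&Q\\0&0\end{pmatrix}\right]\ge\frac12\sqrt{\max\left(\|P+Q\|_A^2,\|P-Q\|_A^2\right)-2\omega_A(PQ^{\sharp_A})}.$$
   Context: $\mathcal{B}(\mathcal{H})$ is the algebra of bounded linear operators on $\mathcal{H}$. The positive semi-definite operator $A$ induces the semi-inner product $\langle x\mid y\rangle_A=\langle Ax\mid y\rangle$ and the seminorm $\|x\|_A=\langle x\mid x\rangle_A^{1/2}=\|A^{1/2}x\|$. An operator $T\in\mathcal{B}(\mathcal{H})$ is $A$-bounded if there is $\lambda>0$ with $\|Tx\|_A\le\lambda\|x\|_A$ for all $x\in\mathcal{H}$; then $\|T\|_A=\sup\{\|Tx\|_A : x\in\mathcal{H},\ \|x\|_A=1\}$. The $A$-numerical radius is $\omega_A(T)=\sup\{|\langle Tx\mid x\rangle_A| : x\in\mathcal{H},\ \|x\|_A=1\}$. $\mathcal{B}_A(\mathcal{H})$ is the set of $T\in\mathcal{B}(\mathcal{H})$ with $\mathcal{R}(T^*A)\subseteq\mathcal{R}(A)$ ($\mathcal{R}$ denotes range), equivalently those admitting an $A$-adjoint, i.e. a bounded $X$ with $AX=T^*A$; all such $T$ are $A$-bounded. For $T\in\mathcal{B}_A(\mathcal{H})$,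 $T^{\sharp_A}$ is the unique bounded solution $X$ of $AX=T^*A$ with $\mathcal{R}(X)\subseteq\overline{\mathcal{R}(A)}$. The operator $\mathbb{A}$ is a positive operator on $\mathcal{H}\oplus\mathcal{H}$, with $\langle x,y\rangle_{\mathbb{A}}=\langle x_1\mid y_1\rangle_A+\langle x_2\mid y_2\rangle_A$ for $x=(x_1,x_2)$, $y=(y_1,y_2)$; $\|\cdot\|_{\mathbb{A}}$ and $\omega_{\mathbb{A}}$ are defined in the same way with $(\mathcal{H}\oplus\mathcal{H},\mathbb{A})$ in place of $(\mathcal{H},A)$. A $2\times2$ matrix of operators on $\mathcal{H}$ denotes the corresponding operator on $\mathcal{H}\oplus\mathcal{H}$. *)

theory Defs
  imports "HOL-Analysis.Analysis"
begin

text \<open>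
  Complex Hilbert spaces, built on the library's real inner product spaces: the real inner
  product is the real part of the complex one, so that norm, topology and completeness are the
  library's.  The inner product is linear in its first argument.  The remaining axioms
  (unitality of the scalar action, definiteness, \<open>norm x = sqrt (Re (cinner x x))\<close>) follow from
  those of \<^class>\<open>real_inner\<close>.
\<close>

class chilbert_space = real_inner + complete_space +
  fixes scaleC :: "complex \<Rightarrow> 'a \<Rightarrow> 'a" (infixr "*\<^sub>C" 75)
    and cinner :: "'a \<Rightarrow> 'a \<Rightarrow> complex"
  assumes scaleC_add_right: "c *\<^sub>C (x + y) = c *\<^sub>C x + c *\<^sub>C y"
    and scaleC_add_left: "(c + d) *\<^sub>C x = c *\<^sub>C x + d *\<^sub>C x"
    and scaleC_scaleC: "c *\<^sub>C d *\<^sub>C x = (c * d) *\<^sub>C x"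
    and scaleR_scaleC: "r *\<^sub>R x = complex_of_real r *\<^sub>C x"
    and cinner_commute: "cinner x y = cnj (cinner y x)"
    and cinner_add_left: "cinner (x + y) z = cinner x z + cinner y z"
    and cinner_scaleC_left: "cinner (c *\<^sub>C x) y = c * cinner x y"
    and inner_eq_Re_cinner: "inner x y = Re (cinner x y)"

instantiation complex :: chilbert_space
begin

definition scaleC_complex :: "complex \<Rightarrow> complex \<Rightarrow> complex"
  where "scaleC_complex c x = c * x"

definition cinner_complex :: "complex \<Rightarrow> complex \<Rightarrow> complex"
  where "cinner_complex x y = x * cnj y"

instance
  by standard
    (auto simp: scaleC_complex_def cinner_complex_def inner_complex_def scaleR_conv_of_real
      algebra_simps)

end

text \<open>The direct sum of two Hilbert spaces.\<close>

instantiation prod :: (chilbert_space, chilbert_space) chilbert_space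
begin

definition scaleC_prod :: "complex \<Rightarrow> 'a \<times> 'b \<Rightarrow> 'a \<times> 'b"
  where "scaleC_prod c x = (c *\<^sub>C fst x, c *\<^sub>C snd x)"

definition cinner_prod :: "'a \<times> 'b \<Rightarrow> 'a \<times> 'b \<Rightarrow> complex"
  where "cinner_prod x y = cinner (fst x) (fst y) + cinner (snd x) (snd y)"

instance
proof
  fix x y :: "'a \<times> 'b"
  show "cinner x y = cnj (cinner y x)"
    unfolding cinner_prod_def complex_cnj_add
    by (subst (1 2) cinner_commute) (rule refl)
qed (auto simp: scaleC_prod_def cinner_prod_def scaleC_add_right scaleC_add_left scaleC_scaleC
    scaleR_scaleC cinner_add_left cinner_scaleC_left inner_prod_def inner_eq_Re_cinner
    prod_eq_iff algebra_simps)

end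

definition bounded_clinear :: "('a::chilbert_space \<Rightarrow> 'b::chilbert_space) \<Rightarrow> bool"
  where "bounded_clinear T \<longleftrightarrow> bounded_linear T \<and> (\<forall>c x. T (c *\<^sub>C x) = c *\<^sub>C T x)"

definition positive_op :: "('a::chilbert_space \<Rightarrow> 'a) \<Rightarrow> bool"
  where "positive_op A \<longleftrightarrow> bounded_clinear A \<and> (\<forall>x. cinner (A x) x \<in> \<real>\<^sub>\<ge>\<^sub>0)"

definition adjoint_op :: "('a::chilbert_space \<Rightarrow> 'a) \<Rightarrow> ('a \<Rightarrow> 'a)"
  where "adjoint_op T =
    (THE S. bounded_clinear S \<and> (\<forall>x y. cinner (T x) y = cinner x (S y)))"

definition A_inner :: "('a::chilbert_space \<Rightarrow> 'a) \<Rightarrow> 'a \<Rightarrow> 'a \<Rightarrow> complex"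
  where "A_inner A x y = cinner (A x) y"

text \<open>For positive \<open>A\<close> the number \<open>A_inner A x x\<close> is real and nonnegative.\<close>

definition A_norm :: "('a::chilbert_space \<Rightarrow> 'a) \<Rightarrow> 'a \<Rightarrow> real"
  where "A_norm A x = sqrt (Re (A_inner A x x))"

text \<open>
  The suprema below are of nonnegative reals and are taken in \<open>[0, \<infinity>)\<close>.  Inserting \<open>0\<close> changes
  nothing unless there is no \<open>x\<close> with \<open>A_norm A x = 1\<close> (that is, \<open>A = 0\<close>), where it
  gives the usual convention that the supremum of the empty set is \<open>0\<close>.
\<close>

definition A_op_norm :: "('a::chilbert_space \<Rightarrow> 'a) \<Rightarrow> ('a \<Rightarrow> 'a) \<Rightarrow> real"
  where "A_op_norm A T = Sup (insert 0 {A_norm A (T x) | x. A_norm A x = 1})"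

definition A_numerical_radius :: "('a::chilbert_space \<Rightarrow> 'a) \<Rightarrow> ('a \<Rightarrow> 'a) \<Rightarrow> real"
  where "A_numerical_radius A T =
    Sup (insert 0 {cmod (A_inner A (T x) x) | x. A_norm A x = 1})"

definition A_adjointable :: "('a::chilbert_space \<Rightarrow> 'a) \<Rightarrow> ('a \<Rightarrow> 'a) set"
  where "A_adjointable A = {T. bounded_clinear T \<and> range (adjoint_op T \<circ> A) \<subseteq> range A}"

definition A_sharp :: "('a::chilbert_space \<Rightarrow> 'a) \<Rightarrow> ('a \<Rightarrow> 'a) \<Rightarrow> ('a \<Rightarrow> 'a)"
  where "A_sharp A T =
    (THE X. bounded_clinear X \<and> A \<circ> X = adjoint_op T \<circ> A \<and> range X \<subseteq> closure (range A))"

text \<open>\<open>op_matrix P Q R S\<close> has first row \<open>P, Q\<close> and second row \<open>R, S\<close>.\<close>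

definition op_matrix ::
  "('a::chilbert_space \<Rightarrow> 'a) \<Rightarrow> ('a \<Rightarrow> 'a) \<Rightarrow> ('a \<Rightarrow> 'a) \<Rightarrow> ('a \<Rightarrow> 'a) \<Rightarrow> ('a \<times> 'a \<Rightarrow> 'a \<times> 'a)"
  where "op_matrix P Q R S = (\<lambda>(x, y). (P x + Q y, R x + S y))"

end

theory Submission
  imports Defs
begin

text \<open>
  Write \<open>B\<close> for the form \<open>A_inner A\<close>, \<open>N\<close> for the seminorm \<open>A_norm A\<close>, \<open>w\<close> for the numerical radius
  on the left and \<open>r\<close> for that of \<open>P \<circ> A_sharp A Q\<close>.  Let \<open>P'\<close> and \<open>Q'\<close> be the \<open>A\<close>-adjoints of \<open>P\<close> and
  \<open>Q\<close>, let \<open>s = 1\<close> or \<open>s = - 1\<close>, and put \<open>R = P + s Q\<close>, with \<open>A\<close>-adjoint \<open>R' = P' + s Q'\<close>.  Expanding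
  the square gives \<open>(N (R' y))\<^sup>2 = (N (P' y))\<^sup>2 + (N (Q' y))\<^sup>2 + 2 * s * Re (B (P' y) (Q' y))\<close>.

  The cross term is at most \<open>2 * r * (N y)\<^sup>2\<close>, because \<open>B (Q' y) (P' y) = B (P (Q' y)) y\<close>.  For the
  other two terms let \<open>T\<close> be the operator matrix and \<open>v = (P' y, Q' y)\<close>.  Then pairing \<open>T v\<close> with
  \<open>(y, 0)\<close> gives exactly the square of the seminorm of \<open>v\<close>.  By polarization a form is bounded by
  twice its numerical radius (\<open>A_inner_le_numerical_bound\<close>), so the seminorm of \<open>v\<close> is at most
  \<open>2 * w * N y\<close>.  Altogether \<open>(N (R' y))\<^sup>2 \<le> (4 * w\<^sup>2 + 2 * r) * (N y)\<^sup>2\<close>; the same bound passes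
  from \<open>R'\<close> to its \<open>A\<close>-adjoint \<open>R\<close>, and this rearranges to the claim.

  Two things support this computation.  The operator \<open>A_sharp A T\<close> must exist and be an
  \<open>A\<close>-adjoint of \<open>T\<close>: a solution with values in the closure of the range of \<open>A\<close> comes from an
  orthogonal projection, and its boundedness (the analytic half of Douglas' factorization theorem)
  from the fact that weakly bounded sets are bounded.  Moreover the suprema that define the
  numerical radii must be over bounded sets.  This follows once an operator with a bounded
  \<open>A\<close>-adjoint is known to be \<open>A\<close>-bounded, which is an iteration argument
  (\<open>A_symmetric_imp_A_bounded\<close>) since \<open>A\<close> need not be invertible.
\<close>

section \<open>Projections, Riesz representation and weak boundedness\<close>

lemma closure_real_subspace:
  fixes S :: "'a::real_normed_vector set"
  assumes "subspace S"
  shows "subspace (closure S)"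
proof (rule subspaceI)
  show "0 \<in> closure S"
    using subspace_0[OF assms] closure_subset by blast
next
  fix x y assume "x \<in> closure S" "y \<in> closure S"
  then obtain f g where "\<And>n. f n \<in> S" "f \<longlonglongrightarrow> x" "\<And>n. g n \<in> S" "g \<longlonglongrightarrow> y"
    unfolding closure_sequential by blast
  then show "x + y \<in> closure S"
    unfolding closure_sequential
    by (intro exI[of _ "\<lambda>n. f n + g n"]) (auto intro: tendsto_add subspace_add[OF assms])
next
  fix c x assume "x \<in> closure S"
  then obtain f where "\<And>n. f n \<in> S" "f \<longlonglongrightarrow> x"
    unfolding closure_sequential by blast
  then show "c *\<^sub>R x \<in> closure S"
    unfolding closure_sequential
    by (intro exI[of _ "\<lambda>n. c *\<^sub>R f n"])
      (auto intro: tendsto_scaleR subspace_scale[OF assms])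
qed

text \<open>
  A minimizing sequence is Cauchy: by the parallelogram law, two points that are almost at minimal
  distance from \<open>x\<close> are close, as their midpoint is in \<open>M\<close> too and cannot be nearer.
\<close>

lemma nearest_point_exists:
  fixes M :: "'a::{real_inner,complete_space} set"
  assumes "closed M" and "convex M" and "M \<noteq> {}"
  shows "\<exists>p\<in>M. \<forall>z\<in>M. dist x p \<le> dist x z"
proof -
  define d where "d = Inf (dist x ` M)"
  have bdd: "bdd_below (dist x ` M)"
    by (rule bdd_belowI[of _ 0]) auto
  have d_le: "d \<le> dist x z" if "z \<in> M" for z
    unfolding d_def by (rule cInf_lower) (use that bdd in auto)
  have d_nonneg: "0 \<le> d"
    unfolding d_def by (rule cInf_greatest) (use assms in auto)
  have "\<exists>z\<in>M. dist x z < d + inverse (real (Suc n))" for n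
    using cInf_lessD[of "dist x ` M" "d + inverse (real (Suc n))"] assms(3)
    unfolding d_def by auto
  then obtain f where fM: "\<And>n. f n \<in> M"
    and f_less: "\<And>n. dist x (f n) < d + inverse (real (Suc n))"
    by metis
  have f_lim: "(\<lambda>n. dist x (f n)) \<longlonglongrightarrow> d"
  proof (rule tendsto_sandwich[where f = "\<lambda>_. d" and h = "\<lambda>n. d + inverse (real (Suc n))"])
    show "(\<lambda>n. d + inverse (real (Suc n))) \<longlonglongrightarrow> d"
      using tendsto_add[OF tendsto_const[of d] LIMSEQ_inverse_real_of_nat] by simp
  qed (use d_le fM f_less in \<open>auto intro!: always_eventually less_imp_le simp del: of_nat_Suc\<close>)
  have gap: "(dist (f m) (f n))\<^sup>2 \<le> 2 * ((dist x (f m))\<^sup>2 - d\<^sup>2) + 2 * ((dist x (f n))\<^sup>2 - d\<^sup>2)" for m n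
  proof -
    let ?mid = "(1/2) *\<^sub>R f m + (1/2) *\<^sub>R f n"
    have "?mid \<in> M"
      using convexD[OF assms(2) fM[of m] fM[of n], of "1/2" "1/2"] by simp
    then have "d\<^sup>2 \<le> (norm (x - ?mid))\<^sup>2"
      using d_le[of ?mid] d_nonneg by (simp add: dist_norm power_mono)
    moreover have "4 * (norm (x - ?mid))\<^sup>2 + (norm (f m - f n))\<^sup>2
        = 2 * (norm (x - f m))\<^sup>2 + 2 * (norm (x - f n))\<^sup>2"
      unfolding power2_norm_eq_inner
      by (simp add: inner_diff inner_add inner_commute algebra_simps)
    ultimately show ?thesis
      by (simp add: dist_norm)
  qed
  have "Cauchy f"
  proof (rule metric_CauchyI)
    fix e :: real assume "0 < e"
    have "(\<lambda>n. (dist x (f n))\<^sup>2) \<longlonglongrightarrow> d\<^sup>2"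
      by (intro tendsto_power f_lim)
    then obtain N where N: "\<And>n. n \<ge> N \<Longrightarrow> \<bar>(dist x (f n))\<^sup>2 - d\<^sup>2\<bar> < e\<^sup>2 / 4"
      using \<open>0 < e\<close> unfolding LIMSEQ_iff by (metis real_norm_def zero_less_divide_iff zero_less_numeral zero_less_power)
    have "dist (f m) (f n) < e" if "m \<ge> N" "n \<ge> N" for m n
    proof -
      have "(dist (f m) (f n))\<^sup>2 < e\<^sup>2"
        using gap[of m n] N[OF that(1), THEN abs_less_iff[THEN iffD1]]
          N[OF that(2), THEN abs_less_iff[THEN iffD1]] by (simp add: field_simps)
      then show ?thesis
        using \<open>0 < e\<close> by (simp add: power2_less_imp_less)
    qed
    then show "\<exists>N. \<forall>m\<ge>N. \<forall>n\<ge>N. dist (f m) (f n) < e" by blast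
  qed
  then obtain p where p: "f \<longlonglongrightarrow> p"
    using Cauchy_convergent convergent_def by blast
  have "p \<in> M"
    using closed_sequentially[OF assms(1)] fM p by blast
  moreover have "dist x p = d"
    using LIMSEQ_unique[OF tendsto_dist[OF tendsto_const p] f_lim] .
  ultimately show ?thesis
    using d_le by blast
qed

lemma orthogonal_projection_exists:
  fixes M :: "'a::{real_inner,complete_space} set"
  assumes "closed M" and "subspace M"
  shows "\<exists>p\<in>M. \<forall>z\<in>M. inner (x - p) z = 0"
proof -
  have "M \<noteq> {}"
    using subspace_0[OF assms(2)] by auto
  then obtain p where p: "p \<in> M" "\<forall>z\<in>M. dist x p \<le> dist x z"
    using nearest_point_exists[OF assms(1) subspace_imp_convex[OF assms(2)]] by blast
  have le: "inner (x - p) z \<le> 0" if "z \<in> M" for z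
    using any_closest_point_dot[OF subspace_imp_convex[OF assms(2)] assms(1) p(1) _ p(2), of "p + z"]
      subspace_add[OF assms(2) p(1) that] by simp
  have "inner (x - p) z = 0" if "z \<in> M" for z
    using le[OF that] le[OF subspace_neg[OF assms(2) that]] by simp
  with p(1) show ?thesis by blast
qed

text \<open>
  The representing vector is a multiple of the component \<open>u\<close> of any vector outside the kernel that
  is orthogonal to the kernel, because \<open>x\<close> minus a suitable multiple of \<open>u\<close> is in the kernel.
\<close>

lemma riesz_representation:
  fixes f :: "'a::{real_inner,complete_space} \<Rightarrow> real"
  assumes "bounded_linear f"
  shows "\<exists>z. \<forall>x. f x = inner x z"
proof (cases "\<forall>x. f x = 0")
  case True
  then show ?thesis by (auto intro: exI[of _ 0])
next
  case False
  then obtain a where a: "f a \<noteq> 0" by blast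
  interpret f: bounded_linear f by fact
  let ?K = "{x. f x = 0}"
  have "closed ?K"
    by (intro closed_Collect_eq continuous_intros f.continuous_on)
  moreover have "subspace ?K"
    by (auto simp: subspace_def f.add f.scaleR f.zero)
  ultimately obtain p where p: "f p = 0" "\<And>z. f z = 0 \<Longrightarrow> inner (a - p) z = 0"
    using orthogonal_projection_exists[of ?K a] by auto
  define u where "u = a - p"
  have fu: "f u \<noteq> 0"
    using a p(1) by (simp add: u_def f.diff)
  then have uu: "inner u u \<noteq> 0"
    using f.zero by auto
  have "f x = inner x ((f u / inner u u) *\<^sub>R u)" for x
  proof -
    have "f (x - (f x / f u) *\<^sub>R u) = 0"
      using fu by (simp add: f.diff f.scaleR)
    then have "inner u (x - (f x / f u) *\<^sub>R u) = 0"
      using p(2) unfolding u_def by blast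
    then show ?thesis
      using fu uu by (simp add: inner_diff_right inner_commute field_simps)
  qed
  then show ?thesis by blast
qed

text \<open>
  The uniform boundedness principle for the functionals \<open>\<lambda>y. inner y z\<close>.  By Baire's theorem one of
  the closed sets of those \<open>y\<close> on which all of them are at most \<open>n\<close> in absolute value contains a ball, and the
  difference of two points of that ball can be taken parallel to any \<open>z\<close>.
\<close>

lemma weakly_bounded_imp_bounded:
  fixes F :: "'a::{real_inner,complete_space} set"
  assumes "\<And>y. \<exists>B. \<forall>z\<in>F. \<bar>inner y z\<bar> \<le> B"
  shows "\<exists>C\<ge>0. \<forall>z\<in>F. norm z \<le> C"
proof -
  define K where "K n = {y. \<forall>z\<in>F. \<bar>inner y z\<bar> \<le> real n}" for n :: nat
  have closed_K: "closed (K n)" for n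
    unfolding K_def Collect_ball_eq
    by (intro closed_INT ballI closed_Collect_le continuous_intros)
  have "\<exists>n. interior (K n) \<noteq> {}"
  proof (rule ccontr)
    assume "\<nexists>n. interior (K n) \<noteq> {}"
    then have "(euclidean::'a topology) interior_of (\<Union>(range K)) = {}"
      using closed_K completely_metrizable_space_euclidean
      by (intro Baire_category_alt) auto
    moreover have "y \<in> \<Union>(range K)" for y
    proof -
      obtain B where "\<forall>z\<in>F. \<bar>inner y z\<bar> \<le> B" using assms by blast
      then have "y \<in> K (nat \<lceil>B\<rceil>)"
        unfolding K_def using order_trans real_nat_ceiling_ge by blast
      then show ?thesis by blast
    qed
    then have "\<Union>(range K) = UNIV" by blast
    ultimately show False by simp
  qed
  then obtain n y r where "0 < r" and r: "cball y r \<subseteq> K n"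
    by (metis all_not_in_conv mem_interior_cball)
  have "norm z \<le> 2 * real n / r" if z: "z \<in> F" for z
  proof (cases "z = 0")
    case False
    let ?h = "(r / norm z) *\<^sub>R z"
    have "y + ?h \<in> K n" "y \<in> K n"
      using \<open>0 < r\<close> False r by (auto simp: dist_norm subset_iff)
    then have "\<bar>inner (y + ?h) z\<bar> \<le> real n" "\<bar>inner y z\<bar> \<le> real n"
      using z unfolding K_def by auto
    then have "inner ?h z \<le> 2 * real n"
      by (simp add: inner_add_left)
    moreover have "inner ?h z = r * norm z"
      using False by (simp add: power2_norm_eq_inner[symmetric] power2_eq_square)
    ultimately show ?thesis
      using \<open>0 < r\<close> by (simp add: field_simps)
  qed (use \<open>0 < r\<close> in simp)
  then show ?thesis
    using \<open>0 < r\<close> by (intro exI[of _ "2 * real n / r"]) auto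
qed

section \<open>Adjoints of bounded complex linear operators\<close>

lemma cinner_add_right: "cinner x (y + z) = cinner x y + cinner x z"
  by (metis cinner_add_left cinner_commute complex_cnj_add)

lemma cinner_scaleC_right: "cinner x (c *\<^sub>C y) = cnj c * cinner x y"
  by (metis cinner_commute cinner_scaleC_left complex_cnj_mult)

text \<open>
  Through this formula an identity between real inner products that is preserved by the complex
  scalars gives the identity between the complex ones.
\<close>

lemma Im_cinner: "Im (cinner x y) = - inner (\<i> *\<^sub>C x) y"
  by (simp add: inner_eq_Re_cinner cinner_scaleC_left)

lemma norm_scaleC: "norm (c *\<^sub>C x) = cmod c * norm (x::'a::chilbert_space)"
proof -
  have "cinner x x \<in> \<real>"
    using cinner_commute[of x x] by (metis Reals_cnj_iff)
  moreover have "(norm z)\<^sup>2 = Re (cinner z z)" for z :: 'a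
    by (simp add: power2_norm_eq_inner inner_eq_Re_cinner)
  ultimately have "(norm (c *\<^sub>C x))\<^sup>2 = (cmod c)\<^sup>2 * (norm x)\<^sup>2"
    by (auto elim!: Reals_cases simp: cinner_scaleC_left cinner_scaleC_right cmod_power2)
      (simp add: power2_eq_square algebra_simps)
  then have "(norm (c *\<^sub>C x))\<^sup>2 = (cmod c * norm x)\<^sup>2"
    by (simp only: power_mult_distrib)
  then show ?thesis by simp
qed

lemma bounded_linear_scaleC: "bounded_linear (\<lambda>x::'a::chilbert_space. c *\<^sub>C x)"
proof (rule bounded_linear_intro[where K = "cmod c"])
  show "c *\<^sub>C r *\<^sub>R x = r *\<^sub>R c *\<^sub>C x" for r and x :: 'a
    by (simp add: scaleR_scaleC scaleC_scaleC mult.commute)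
qed (auto simp: scaleC_add_right norm_scaleC mult.commute)

lemma bounded_clinearD:
  assumes "bounded_clinear T"
  shows "bounded_linear T" and "T (c *\<^sub>C x) = c *\<^sub>C T x" and "T (x + y) = T x + T y"
  using assms bounded_linear.linear linear_add unfolding bounded_clinear_def by blast+

lemma adjoint_exists:
  fixes T :: "'a::chilbert_space \<Rightarrow> 'b::chilbert_space"
  assumes T: "bounded_clinear T"
  shows "\<exists>S. bounded_clinear S \<and> (\<forall>x y. cinner (T x) y = cinner x (S y))"
proof -
  interpret T: bounded_linear T
    using T by (rule bounded_clinearD)
  have "\<exists>z. \<forall>x. inner (T x) y = inner x z" for y
    by (rule riesz_representation) (intro bounded_linear_inner_left_comp T.bounded_linear_axioms)
  then obtain S where S: "\<And>x y. inner (T x) y = inner x (S y)" by metis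
  have adj: "cinner (T x) y = cinner x (S y)" for x y
    by (rule complex_eqI)
      (simp_all add: Im_cinner inner_eq_Re_cinner[symmetric] S bounded_clinearD(2)[OF T, symmetric])
  obtain K where K: "0 \<le> K" "\<And>x. norm (T x) \<le> norm x * K"
    using T.nonneg_bounded by blast
  have eqI: "a = b" if "\<And>x. inner x a = inner x b" for a b :: 'a
    using that vector_eq_ldot by blast
  have "bounded_linear S"
  proof (rule bounded_linear_intro[where K = K])
    show "S (y + z) = S y + S z" for y z
      by (rule eqI) (simp add: inner_add_right S[symmetric])
    show "S (r *\<^sub>R y) = r *\<^sub>R S y" for r y
      by (rule eqI) (simp add: S[symmetric])
    show "norm (S y) \<le> norm y * K" for y
    proof (cases "S y = 0")
      case False
      have "norm (S y) * norm (S y) = inner (T (S y)) y"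
        by (simp add: S power2_norm_eq_inner[symmetric] power2_eq_square)
      also have "\<dots> \<le> norm (T (S y)) * norm y"
        by (rule norm_cauchy_schwarz)
      also have "\<dots> \<le> (norm (S y) * K) * norm y"
        by (intro mult_right_mono K) auto
      finally show ?thesis
        using False by (simp add: mult.assoc mult.commute)
    qed (use K(1) in simp)
  qed
  moreover have "S (c *\<^sub>C y) = c *\<^sub>C S y" for c y
    by (rule eqI) (simp add: inner_eq_Re_cinner cinner_scaleC_right adj[symmetric])
  ultimately show ?thesis
    using adj unfolding bounded_clinear_def by blast
qed

lemma adjoint_op_works:
  assumes "bounded_clinear T"
  shows "bounded_clinear (adjoint_op T)" and "cinner (T x) y = cinner x (adjoint_op T y)"
proof -
  let ?P = "\<lambda>S. bounded_clinear S \<and> (\<forall>x y. cinner (T x) y = cinner x (S y))"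
  have "\<exists>!S. ?P S"
  proof (rule ex_ex1I)
    show "\<exists>S. ?P S" using adjoint_exists[OF assms] .
    fix S S' assume *: "?P S" "?P S'"
    then have "inner x (S y) = inner x (S' y)" for x y
      unfolding inner_eq_Re_cinner by metis
    then show "S = S'"
      using vector_eq_ldot by blast
  qed
  then have "?P (adjoint_op T)"
    unfolding adjoint_op_def by (rule theI')
  then show "bounded_clinear (adjoint_op T)" "cinner (T x) y = cinner x (adjoint_op T y)"
    by blast+
qed

section \<open>The seminorm of a positive operator\<close>

locale semi_hilbertian =
  fixes A :: "'a::chilbert_space \<Rightarrow> 'a"
  assumes positive: "positive_op A"
begin

lemma bounded_clinear_A: "bounded_clinear A"
  using positive unfolding positive_op_def by blast

lemma A_inner_add_left: "A_inner A (x + y) z = A_inner A x z + A_inner A y z"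
  by (simp add: A_inner_def bounded_clinearD[OF bounded_clinear_A] cinner_add_left)

lemma A_inner_add_right: "A_inner A x (y + z) = A_inner A x y + A_inner A x z"
  by (simp add: A_inner_def cinner_add_right)

lemma A_inner_scaleC_left: "A_inner A (c *\<^sub>C x) y = c * A_inner A x y"
  by (simp add: A_inner_def bounded_clinearD[OF bounded_clinear_A] cinner_scaleC_left)

lemma A_inner_scaleC_right: "A_inner A x (c *\<^sub>C y) = cnj c * A_inner A x y"
  by (simp add: A_inner_def cinner_scaleC_right)

lemma A_inner_self: "A_inner A x x = complex_of_real ((A_norm A x)\<^sup>2)"
proof -
  have "A_inner A x x \<in> \<real>\<^sub>\<ge>\<^sub>0"
    using positive unfolding positive_op_def A_inner_def by blast
  then show ?thesis
    by (auto elim!: nonneg_Reals_cases simp: A_norm_def simp del: of_real_power)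
qed

lemma A_norm_nonneg [simp]: "0 \<le> A_norm A x"
proof -
  have "A_inner A x x \<in> \<real>\<^sub>\<ge>\<^sub>0"
    using positive unfolding positive_op_def A_inner_def by blast
  then show ?thesis
    by (auto elim!: nonneg_Reals_cases simp: A_norm_def)
qed

text \<open>
  A form with real diagonal is Hermitian: the diagonal values at \<open>x + y\<close> and \<open>x + \<i> y\<close> determine the
  imaginary and the real part of \<open>A_inner A x y - cnj (A_inner A y x)\<close>.
\<close>

lemma A_inner_commute: "A_inner A x y = cnj (A_inner A y x)"
proof -
  let ?B = "A_inner A"
  have "Im (?B (x + y) (x + y)) = 0" "Im (?B (x + \<i> *\<^sub>C y) (x + \<i> *\<^sub>C y)) = 0"
    "Im (?B x x) = 0" "Im (?B y y) = 0"
    unfolding A_inner_self by simp_all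
  then show ?thesis
    by (auto simp: complex_eq_iff A_inner_add_left A_inner_add_right A_inner_scaleC_left
        A_inner_scaleC_right)
qed

lemma A_norm_scaleC: "A_norm A (c *\<^sub>C x) = cmod c * A_norm A x"
proof -
  have "complex_of_real ((A_norm A (c *\<^sub>C x))\<^sup>2) = complex_of_real ((cmod c * A_norm A x)\<^sup>2)"
    unfolding A_inner_self[symmetric] A_inner_scaleC_left A_inner_scaleC_right power_mult_distrib
    by (simp add: A_inner_self complex_norm_square mult_ac del: of_real_power)
  then show ?thesis
    by (simp only: of_real_eq_iff) simp
qed

lemma A_norm_add_sq:
  "(A_norm A (x + y))\<^sup>2 = (A_norm A x)\<^sup>2 + (A_norm A y)\<^sup>2 + 2 * Re (A_inner A x y)"
proof -
  have "(A_norm A z)\<^sup>2 = Re (A_inner A z z)" for z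
    by (simp add: A_inner_self)
  moreover have "Re (A_inner A y x) = Re (A_inner A x y)"
    by (subst A_inner_commute) simp
  ultimately show ?thesis
    by (simp add: A_inner_add_left A_inner_add_right)
qed

text \<open>
  The form may be degenerate, so there are two cases in the usual argument.  Both use that the
  squared seminorm of \<open>x + t y\<close> is nonnegative when \<open>t\<close> is \<open>- s\<close> times the value of the form.
\<close>

lemma A_cauchy_schwarz: "cmod (A_inner A x y) \<le> A_norm A x * A_norm A y"
proof -
  define b where "b = cmod (A_inner A x y)"
  have quad: "0 \<le> (A_norm A x)\<^sup>2 + s\<^sup>2 * b\<^sup>2 * (A_norm A y)\<^sup>2 - 2 * s * b\<^sup>2" for s
  proof -
    let ?t = "complex_of_real (- s) * A_inner A x y"
    have "Re (cnj ?t * A_inner A x y) = - s * b\<^sup>2"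
      unfolding b_def cmod_power2 by (simp add: power2_eq_square algebra_simps)
    moreover have "cmod ?t = \<bar>s\<bar> * b"
      by (simp add: b_def norm_mult)
    ultimately have "(A_norm A (x + ?t *\<^sub>C y))\<^sup>2
        = (A_norm A x)\<^sup>2 + (\<bar>s\<bar> * b * A_norm A y)\<^sup>2 + 2 * (- s * b\<^sup>2)"
      unfolding A_norm_add_sq A_norm_scaleC A_inner_scaleC_right by simp
    then show ?thesis
      using zero_le_power2[of "A_norm A (x + ?t *\<^sub>C y)"] by (simp add: power_mult_distrib)
  qed
  have "b\<^sup>2 \<le> (A_norm A x * A_norm A y)\<^sup>2"
  proof (cases "A_norm A y = 0")
    case True
    have "b = 0"
    proof (rule ccontr)
      \<comment> \<open>Here \<open>quad\<close> is affine in \<open>s\<close> with slope \<open>- 2 * b\<^sup>2\<close>, so it fails for this large \<open>s\<close>.\<close>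
      assume "b \<noteq> 0"
      then show False
        using quad[of "((A_norm A x)\<^sup>2 + 1) / (2 * b\<^sup>2)"] True by simp
    qed
    then show ?thesis by simp
  next
    case False
    have "0 \<le> (A_norm A x)\<^sup>2 - b\<^sup>2 / (A_norm A y)\<^sup>2"
      using quad[of "1 / (A_norm A y)\<^sup>2"] False by (simp add: power2_eq_square)
    then show ?thesis
      using False by (simp add: power_mult_distrib divide_le_eq)
  qed
  then show ?thesis
    unfolding b_def by (rule power2_le_imp_le) simp
qed

text \<open>
  The polarization identity writes four times the value at \<open>(v, u)\<close> as a combination of values at
  \<open>v + \<i>^k u\<close>, and the parallelogram law sums the resulting bounds to
  \<open>w * ((A_norm A v)\<^sup>2 + (A_norm A u)\<^sup>2)\<close>.  The product form follows by replacing \<open>v\<close> and \<open>u\<close> by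
  \<open>t v\<close> and \<open>u / t\<close> and choosing \<open>t\<close> well.
\<close>

lemma A_inner_le_numerical_bound:
  assumes T: "\<And>x y. T (x + y) = T x + T y" "\<And>c x. T (c *\<^sub>C x) = c *\<^sub>C T x"
    and w: "\<And>x. cmod (A_inner A (T x) x) \<le> w * (A_norm A x)\<^sup>2" and "0 \<le> w"
  shows "cmod (A_inner A (T v) u) \<le> 2 * w * A_norm A v * A_norm A u"
proof -
  let ?B = "A_inner A" and ?N = "A_norm A"
  have sum_bound: "cmod (?B (T v) u) \<le> w * ((?N v)\<^sup>2 + (?N u)\<^sup>2)" for u v
  proof -
    define q where "q k = ?B (T (v + \<i>^k *\<^sub>C u)) (v + \<i>^k *\<^sub>C u)" for k :: nat
    define n where "n k = (?N (v + \<i>^k *\<^sub>C u))\<^sup>2" for k :: nat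
    have "4 * ?B (T v) u = q 0 + \<i> * q 1 - q 2 - \<i> * q 3"
      unfolding q_def
      by (simp add: T A_inner_add_left A_inner_add_right A_inner_scaleC_left A_inner_scaleC_right
          eval_nat_numeral algebra_simps)
    then have "4 * cmod (?B (T v) u) = cmod (q 0 + \<i> * q 1 - q 2 - \<i> * q 3)"
      by (metis norm_mult norm_numeral)
    also have "\<dots> \<le> cmod (q 0) + cmod (q 1) + cmod (q 2) + cmod (q 3)"
      by (intro order_trans[OF norm_triangle_ineq4] add_mono order_trans[OF norm_triangle_ineq])
        (auto simp: norm_mult)
    also have "\<dots> \<le> w * n 0 + w * n 1 + w * n 2 + w * n 3"
      unfolding q_def n_def by (intro add_mono w)
    also have "\<dots> = w * (n 0 + n 1 + n 2 + n 3)"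
      by (simp add: algebra_simps)
    also have "n 0 + n 1 + n 2 + n 3 = 4 * ((?N v)\<^sup>2 + (?N u)\<^sup>2)"
      unfolding n_def A_norm_add_sq A_norm_scaleC A_inner_scaleC_right
      by (simp add: eval_nat_numeral norm_mult)
    finally show ?thesis by (simp add: algebra_simps)
  qed
  define a b where "a = ?N v" and "b = ?N u"
  have ab: "0 \<le> a" "0 \<le> b" by (simp_all add: a_def b_def)
  have "cmod (?B (T v) u) \<le> 2 * w * a * b + e * (w * (a + b))" if "0 < e" for e
  proof -
    \<comment> \<open>The best choice is \<open>t\<^sup>2 = b / a\<close>; the perturbation by \<open>e\<close> covers vanishing seminorms.\<close>
    define t where "t = sqrt ((b + e) / (a + e))"
    have t: "0 < t" "t\<^sup>2 = (b + e) / (a + e)"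
      using ab that by (simp_all add: t_def)
    have "?B (T (of_real t *\<^sub>C v)) (of_real (1/t) *\<^sub>C u) = ?B (T v) u"
      using t by (simp add: T A_inner_scaleC_left A_inner_scaleC_right)
    then have "cmod (?B (T v) u) \<le> w * ((t * a)\<^sup>2 + (b / t)\<^sup>2)"
      using sum_bound[of "of_real t *\<^sub>C v" "of_real (1/t) *\<^sub>C u"] t
      by (simp add: A_norm_scaleC a_def b_def norm_divide)
    also have "\<dots> \<le> w * ((b + e) * a + b * (a + e))"
    proof (intro mult_left_mono add_mono \<open>0 \<le> w\<close>)
      have "(t * a)\<^sup>2 = (b + e) * a * (a / (a + e))"
        unfolding power_mult_distrib t(2) by (simp add: power2_eq_square)
      also have "\<dots> \<le> (b + e) * a * 1"
        using ab that by (intro mult_left_mono) auto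
      finally show "(t * a)\<^sup>2 \<le> (b + e) * a" by simp
      have "(b / t)\<^sup>2 = b * (a + e) * (b / (b + e))"
        unfolding power_divide t(2) by (simp add: power2_eq_square)
      also have "\<dots> \<le> b * (a + e) * 1"
        using ab that by (intro mult_left_mono) auto
      finally show "(b / t)\<^sup>2 \<le> b * (a + e)" by simp
    qed
    finally show ?thesis by (simp add: algebra_simps)
  qed
  moreover have "((\<lambda>e. 2 * w * a * b + e * (w * (a + b))) \<longlongrightarrow> 2 * w * a * b + 0 * (w * (a + b)))
      (at_right 0)"
    by (intro tendsto_intros)
  ultimately have "cmod (?B (T v) u) \<le> 2 * w * a * b + 0 * (w * (a + b))"
    by (intro tendsto_lowerbound) (auto simp: eventually_at_filter)
  then show ?thesis by (simp add: a_def b_def)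
qed

lemma A_norm_le_norm: "\<exists>k\<ge>0. \<forall>x. A_norm A x \<le> k * norm x"
proof -
  obtain K where K: "0 \<le> K" "\<And>x. norm (A x) \<le> norm x * K"
    using bounded_linear.nonneg_bounded[OF bounded_clinearD(1)[OF bounded_clinear_A]] by blast
  have "A_norm A x \<le> sqrt K * norm x" for x
  proof -
    have "Re (A_inner A x x) \<le> norm (A x) * norm x"
      unfolding A_inner_def inner_eq_Re_cinner[symmetric] by (rule norm_cauchy_schwarz)
    also have "\<dots> \<le> (norm x * K) * norm x"
      by (intro mult_right_mono K) simp
    also have "\<dots> = K * (norm x)\<^sup>2"
      by (simp add: power2_eq_square)
    finally have "A_norm A x \<le> sqrt (K * (norm x)\<^sup>2)"
      unfolding A_norm_def by (rule real_sqrt_le_mono)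
    then show ?thesis by (simp add: real_sqrt_mult)
  qed
  then show ?thesis using K(1) by (intro exI[of _ "sqrt K"]) auto
qed

text \<open>
  By symmetry and the Cauchy-Schwarz inequality the seminorms \<open>a n\<close> of the iterates of \<open>x\<close> under \<open>S\<close>
  form a log-convex sequence, which therefore grows at least like the powers of its first ratio
  \<open>a 1 / a 0\<close>.  The seminorm is bounded by a multiple of the norm, and so \<open>a n\<close> grows at most like
  \<open>k ^ n\<close>.  Hence the first ratio is at most \<open>k\<close>.
\<close>

lemma A_symmetric_imp_A_bounded:
  assumes sym: "\<And>x y. A_inner A (S x) y = A_inner A x (S y)"
    and "0 \<le> k" and k: "\<And>x. norm (S x) \<le> k * norm x"
  shows "A_norm A (S x) \<le> k * A_norm A x"
proof (rule ccontr)
  let ?N = "A_norm A"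
  assume contra: "\<not> ?N (S x) \<le> k * ?N x"
  define a where "a n = ?N ((S ^^ n) x)" for n
  have step: "(a (Suc n))\<^sup>2 \<le> a n * a (Suc (Suc n))" for n
  proof -
    have "(a (Suc n))\<^sup>2 = cmod (A_inner A ((S ^^ n) x) ((S ^^ Suc (Suc n)) x))"
      using A_inner_self[of "(S ^^ Suc n) x"] by (simp add: a_def sym del: of_real_power)
    then show ?thesis
      using A_cauchy_schwarz unfolding a_def by metis
  qed
  have a1: "a 0 * k < a 1" and a_nonneg: "\<And>n. 0 \<le> a n"
    using contra by (auto simp: a_def mult.commute)
  have a0: "0 < a 0"
  proof -
    have "0 < a 1" using a1 a_nonneg[of 0] \<open>0 \<le> k\<close> by (smt (verit) mult_nonneg_nonneg)
    then have "0 < a 0 * a 2" using step[of 0] by (smt (verit) numeral_2_eq_2 One_nat_def zero_less_power)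
    then show ?thesis using a_nonneg[of 0] by (metis less_eq_real_def mult_zero_left less_irrefl)
  qed
  define r where "r = a 1 / a 0"
  have r: "k < r" "0 < r"
  proof -
    show "k < r"
      using a1 a0 by (simp add: r_def less_divide_eq mult.commute)
    then show "0 < r"
      using \<open>0 \<le> k\<close> by linarith
  qed
  have growth: "0 < a n \<and> r * a n \<le> a (Suc n)" for n
  proof (induction n)
    case 0
    then show ?case using a0 by (simp add: r_def)
  next
    case (Suc n)
    then have pos: "0 < a (Suc n)"
      using r by (smt (verit) mult_pos_pos)
    have "a n * (r * a (Suc n)) = (r * a n) * a (Suc n)" by simp
    also have "\<dots> \<le> a (Suc n) * a (Suc n)"
      using Suc pos by (intro mult_right_mono) auto
    also have "\<dots> \<le> a n * a (Suc (Suc n))"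
      using step[of n] by (simp add: power2_eq_square)
    finally show ?case using Suc pos by simp
  qed
  have lower: "a 0 * r ^ n \<le> a n" for n
  proof (induction n)
    case (Suc n)
    then have "r * (a 0 * r ^ n) \<le> r * a n" using r by simp
    then show ?case using growth[of n] by (simp add: mult.left_commute)
  qed simp
  obtain c where c: "0 \<le> c" "\<And>x. ?N x \<le> c * norm x"
    using A_norm_le_norm by blast
  have iter: "norm ((S ^^ n) x) \<le> k ^ n * norm x" for n
  proof (induction n)
    case (Suc n)
    then have "k * norm ((S ^^ n) x) \<le> k * (k ^ n * norm x)"
      using \<open>0 \<le> k\<close> by (rule mult_left_mono)
    then show ?case using k[of "(S ^^ n) x"] by (simp add: mult.assoc)
  qed simp
  have bound: "a 0 \<le> c * norm x * (k / r) ^ n" for n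
  proof -
    have "a 0 * r ^ n \<le> c * (k ^ n * norm x)"
      using lower[of n] c(2)[of "(S ^^ n) x"] mult_left_mono[OF iter[of n] c(1)]
      unfolding a_def by linarith
    then show ?thesis
      using r by (simp add: field_simps power_divide)
  qed
  have "(\<lambda>n. c * norm x * (k / r) ^ n) \<longlonglongrightarrow> c * norm x * 0"
    using r \<open>0 \<le> k\<close> by (intro tendsto_intros LIMSEQ_realpow_zero) auto
  then have "a 0 \<le> c * norm x * 0"
    using bound by (intro LIMSEQ_le_const) auto
  with a0 show False by simp
qed

text \<open>
  The product \<open>X \<circ> T\<close> is symmetric for the form, hence \<open>A\<close>-bounded with its norm bound \<open>k\<close>, and
  \<open>(A_norm A (T x))\<^sup>2\<close> is the value of the form at \<open>x\<close> and \<open>X (T x)\<close>.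
\<close>

lemma A_adjoint_pair_imp_A_bounded:
  assumes T: "bounded_clinear T" and X: "bounded_clinear X"
    and adj: "\<And>x y. A_inner A (T x) y = A_inner A x (X y)"
  shows "\<exists>c\<ge>0. \<forall>x. A_norm A (T x) \<le> c * A_norm A x"
proof -
  have "bounded_linear (\<lambda>x. X (T x))"
    by (rule bounded_linear_compose[OF bounded_clinearD(1)[OF X] bounded_clinearD(1)[OF T]])
  then obtain k where k: "0 \<le> k" "\<And>x. norm (X (T x)) \<le> norm x * k"
    using bounded_linear.nonneg_bounded by blast
  have sym: "A_inner A (X (T x)) y = A_inner A x (X (T y))" for x y
  proof -
    have "A_inner A (X (T x)) y = cnj (A_inner A (T y) (T x))"
      by (subst A_inner_commute) (simp add: adj)
    also have "\<dots> = A_inner A x (X (T y))"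
      by (simp add: A_inner_commute[symmetric] adj[symmetric])
    finally show ?thesis .
  qed
  have "A_norm A (T x) \<le> sqrt k * A_norm A x" for x
  proof (rule power2_le_imp_le)
    have "(A_norm A (T x))\<^sup>2 = cmod (A_inner A x (X (T x)))"
      using A_inner_self[of "T x"] by (simp add: adj del: of_real_power)
    also have "\<dots> \<le> A_norm A x * A_norm A (X (T x))"
      by (rule A_cauchy_schwarz)
    also have "\<dots> \<le> A_norm A x * (k * A_norm A x)"
      using k by (intro mult_left_mono A_symmetric_imp_A_bounded sym) (auto simp: mult.commute)
    also have "\<dots> = (sqrt k * A_norm A x)\<^sup>2"
      using k(1) by (simp add: power_mult_distrib) (simp add: power2_eq_square)
    finally show "(A_norm A (T x))\<^sup>2 \<le> (sqrt k * A_norm A x)\<^sup>2" .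
  qed (use k(1) in simp)
  then show ?thesis using k(1) by (intro exI[of _ "sqrt k"]) auto
qed

section \<open>Existence of the A-adjoint\<close>

lemma cinner_A_left: "cinner (A x) y = cinner x (A y)"
  using A_inner_commute[of x y] unfolding A_inner_def by (subst (2) cinner_commute)

lemma inner_A_left: "inner (A x) y = inner x (A y)"
  by (simp add: inner_eq_Re_cinner cinner_A_left)

lemma subspace_closure_range_A: "subspace (closure (range A))"
  using closure_real_subspace linear_subspace_image[OF _ subspace_UNIV]
    bounded_linear.linear[OF bounded_clinearD(1)[OF bounded_clinear_A]] by blast

lemma scaleC_closure_range_A:
  assumes "z \<in> closure (range A)"
  shows "c *\<^sub>C z \<in> closure (range A)"
proof -
  have "(\<lambda>z. c *\<^sub>C z) ` range A \<subseteq> range A"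
    using bounded_clinearD(2)[OF bounded_clinear_A, symmetric] by auto
  then have "(\<lambda>z. c *\<^sub>C z) ` closure (range A) \<subseteq> closure (range A)"
    by (intro order_trans[OF closure_bounded_linear_image_subset[OF bounded_linear_scaleC]]
        closure_mono)
  with assms show ?thesis by blast
qed

text \<open>
  The kernel of the self-adjoint operator \<open>A\<close> is orthogonal to its range.
\<close>

lemma A_zero_on_closure_range:
  assumes "p \<in> closure (range A)" and "A p = 0"
  shows "p = 0"
proof -
  have "closure (range A) \<subseteq> {z. inner p z = 0}"
    using assms(2)
    by (intro closure_minimal closed_Collect_eq continuous_intros) (auto simp: inner_A_left[symmetric])
  with assms(1) show ?thesis by auto
qed

lemma A_inj_on_closure_range:
  assumes "p \<in> closure (range A)" "q \<in> closure (range A)" and "A p = A q"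
  shows "p = q"
proof -
  interpret A: bounded_linear A
    by (rule bounded_clinearD(1)[OF bounded_clinear_A])
  have "p - q \<in> closure (range A)"
    using assms subspace_diff[OF subspace_closure_range_A] by blast
  then have "p - q = 0"
    by (rule A_zero_on_closure_range) (simp add: A.diff assms(3))
  then show ?thesis by simp
qed

text \<open>
  The component of \<open>w\<close> orthogonal to the range of \<open>A\<close> is in the kernel of \<open>A\<close>, so it can be dropped.
\<close>

lemma A_solution_in_closure_range: "\<exists>p\<in>closure (range A). A p = A w"
proof -
  interpret A: bounded_linear A
    by (rule bounded_clinearD(1)[OF bounded_clinear_A])
  obtain p where p: "p \<in> closure (range A)" "\<forall>z\<in>closure (range A). inner (w - p) z = 0"
    using orthogonal_projection_exists[OF closed_closure subspace_closure_range_A] by blast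
  have "inner (A (w - p)) (A (w - p)) = 0"
    unfolding inner_A_left[of "w - p"] using p(2) closure_subset[of "range A"] by (metis rangeI subsetD)
  then have "A p = A w" by (simp add: A.diff)
  with p(1) show ?thesis by blast
qed

text \<open>
  Projecting pointwise solutions of \<open>A p = adjoint_op T (A y)\<close> gives a map \<open>X\<close>, which is linear because
  \<open>A\<close> is injective on the closure of its range.  For its boundedness note that
  \<open>inner y (A (T w)) = inner (X y) (A w)\<close>.  So the vectors \<open>A (T w)\<close> with \<open>norm (A w) \<le> 1\<close> are weakly
  bounded, with bound \<open>norm (X y)\<close> at \<open>y\<close>, hence bounded by a common \<open>C\<close>.  Read backwards, the
  identity now bounds \<open>inner (X y) z\<close> for \<open>z\<close> in the range of \<open>A\<close>, and by continuity for \<open>z = X y\<close>.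
\<close>

lemma A_sharp_exists:
  assumes "T \<in> A_adjointable A"
  shows "\<exists>X. bounded_clinear X \<and> A \<circ> X = adjoint_op T \<circ> A \<and> range X \<subseteq> closure (range A)"
proof -
  let ?M = "closure (range A)"
  have T: "bounded_clinear T" and rng: "range (adjoint_op T \<circ> A) \<subseteq> range A"
    using assms unfolding A_adjointable_def by auto
  note S = adjoint_op_works(1)[OF T]
  have "\<exists>p\<in>?M. A p = adjoint_op T (A y)" for y
  proof -
    have "adjoint_op T (A y) \<in> range A" using rng by auto
    then show ?thesis using A_solution_in_closure_range by (metis imageE)
  qed
  then obtain X where X: "\<And>y. X y \<in> ?M" "\<And>y. A (X y) = adjoint_op T (A y)" by metis
  have X_add: "X (y + z) = X y + X z" for y z
    by (rule A_inj_on_closure_range)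
      (simp_all add: X subspace_add[OF subspace_closure_range_A] bounded_clinearD[OF S]
        bounded_clinearD[OF bounded_clinear_A])
  have X_scaleC: "X (c *\<^sub>C y) = c *\<^sub>C X y" for c y
    by (rule A_inj_on_closure_range)
      (simp_all add: X scaleC_closure_range_A bounded_clinearD[OF S]
        bounded_clinearD[OF bounded_clinear_A])
  have dual: "inner y (A (T w)) = inner (X y) (A w)" for y w
  proof -
    have "inner y (A (T w)) = inner (A y) (T w)"
      by (simp add: inner_A_left)
    also have "\<dots> = inner (A (X y)) w"
      unfolding X(2) inner_commute[of "A y"] inner_commute[of _ w]
      by (simp add: inner_eq_Re_cinner adjoint_op_works(2)[OF T])
    also have "\<dots> = inner (X y) (A w)"
      by (rule inner_A_left)
    finally show ?thesis .
  qed
  obtain C where C: "0 \<le> C" "\<And>w. norm (A w) \<le> 1 \<Longrightarrow> norm (A (T w)) \<le> C"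
  proof -
    have "\<exists>B. \<forall>z\<in>{A (T w) |w. norm (A w) \<le> 1}. \<bar>inner y z\<bar> \<le> B" for y
    proof -
      have "\<bar>inner y (A (T w))\<bar> \<le> norm (X y)" if "norm (A w) \<le> 1" for w
        using Cauchy_Schwarz_ineq2[of "X y" "A w"] mult_left_mono[OF that, of "norm (X y)"]
        by (simp add: dual)
      then show ?thesis by blast
    qed
    from weakly_bounded_imp_bounded[OF this] show ?thesis using that by blast
  qed
  have on_range: "inner (X y) (A w) \<le> C * norm y * norm (A w)" for y w
  proof (cases "A w = 0")
    case False
    let ?v = "(1 / norm (A w)) *\<^sub>R w"
    have Av: "A ?v = (1 / norm (A w)) *\<^sub>R A w"
      by (simp add: scaleR_scaleC bounded_clinearD[OF bounded_clinear_A])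
    have "inner (X y) (A ?v) \<le> norm y * norm (A (T ?v))"
      unfolding dual[symmetric] by (rule norm_cauchy_schwarz)
    also have "\<dots> \<le> norm y * C"
      using False by (intro mult_left_mono C) (simp_all add: Av)
    finally show ?thesis
      using False by (simp add: Av field_simps)
  qed simp
  have X_bound: "norm (X y) \<le> norm y * C" for y
  proof (cases "X y = 0")
    case False
    have "?M \<subseteq> {z. inner (X y) z \<le> C * norm y * norm z}"
      using on_range by (intro closure_minimal closed_Collect_le continuous_intros) auto
    then have "norm (X y) * norm (X y) \<le> (C * norm y) * norm (X y)"
      using X(1)[of y] by (auto simp: power2_norm_eq_inner[symmetric] power2_eq_square)
    then show ?thesis
      using False by (simp add: mult.commute)
  qed (use C(1) in simp)
  have "bounded_linear X"
    by (rule bounded_linear_intro[where K = C])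
      (simp_all add: X_add X_bound scaleR_scaleC X_scaleC)
  then have "bounded_clinear X"
    unfolding bounded_clinear_def using X_scaleC by blast
  then show ?thesis
    using X by (intro exI[of _ X]) auto
qed

lemma A_sharp_works:
  assumes T: "T \<in> A_adjointable A"
  shows "bounded_clinear (A_sharp A T)"
    and "A_inner A (T x) y = A_inner A x (A_sharp A T y)"
proof -
  let ?P = "\<lambda>X. bounded_clinear X \<and> A \<circ> X = adjoint_op T \<circ> A \<and> range X \<subseteq> closure (range A)"
  have "\<exists>!X. ?P X"
  proof (rule ex_ex1I)
    show "\<exists>X. ?P X" using A_sharp_exists[OF T] .
    fix X Y assume *: "?P X" "?P Y"
    show "X = Y"
    proof
      fix y
      have "A (X y) = A (Y y)" using * by (metis comp_apply)
      moreover have "X y \<in> closure (range A)" "Y y \<in> closure (range A)" using * by blast+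
      ultimately show "X y = Y y" using A_inj_on_closure_range by blast
    qed
  qed
  then have sharp: "?P (A_sharp A T)"
    unfolding A_sharp_def by (rule theI')
  then show "bounded_clinear (A_sharp A T)" by blast
  have bT: "bounded_clinear T"
    using T unfolding A_adjointable_def by blast
  have "A (A_sharp A T y) = adjoint_op T (A y)"
    using sharp by (metis comp_apply)
  then show "A_inner A (T x) y = A_inner A x (A_sharp A T y)"
    unfolding A_inner_def cinner_A_left by (simp add: adjoint_op_works(2)[OF bT])
qed

lemma A_adjoint_flip:
  assumes "\<And>x y. A_inner A (T x) y = A_inner A x (X y)"
  shows "A_inner A (X x) y = A_inner A x (T y)"
  by (metis A_inner_commute assms)

section \<open>Operator norms and numerical radii as bounds\<close>

lemma A_norm_bound_of_A_adjoint:
  assumes adj: "\<And>x y. A_inner A (T x) y = A_inner A x (X y)"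
    and X: "\<And>y. A_norm A (X y) \<le> k * A_norm A y"
  shows "A_norm A (T x) \<le> k * A_norm A x"
proof (cases "A_norm A (T x) = 0")
  case True
  show ?thesis
    using X[of x] A_norm_nonneg[of "X x"] True by linarith
next
  case False
  have "A_norm A (T x) * A_norm A (T x) = cmod (A_inner A x (X (T x)))"
    using A_inner_self[of "T x"] by (simp add: adj power2_eq_square del: of_real_mult)
  also have "\<dots> \<le> A_norm A x * A_norm A (X (T x))"
    by (rule A_cauchy_schwarz)
  also have "\<dots> \<le> A_norm A x * (k * A_norm A (T x))"
    by (intro mult_left_mono X) simp
  finally have "A_norm A (T x) * A_norm A (T x) \<le> (k * A_norm A x) * A_norm A (T x)"
    by (simp add: mult_ac)
  moreover have "0 < A_norm A (T x)"
    using False A_norm_nonneg[of "T x"] by linarith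
  ultimately show ?thesis by simp
qed

lemma A_op_norm_le:
  assumes "0 \<le> k" and "\<And>x. A_norm A (T x) \<le> k * A_norm A x"
  shows "0 \<le> A_op_norm A T" and "A_op_norm A T \<le> k"
proof -
  have ub: "s \<le> k" if "s \<in> insert 0 {A_norm A (T x) |x. A_norm A x = 1}" for s
    using that assms(1) assms(2) by (auto, metis mult.right_neutral)
  then have "bdd_above (insert 0 {A_norm A (T x) |x. A_norm A x = 1})"
    by (rule bdd_aboveI)
  then show "0 \<le> A_op_norm A T"
    unfolding A_op_norm_def by (intro cSup_upper) auto
  show "A_op_norm A T \<le> k"
    unfolding A_op_norm_def using ub by (intro cSup_least) auto
qed

text \<open>
  Some quadratic bound \<open>k\<close> has to be known beforehand: it makes the defining supremum a proper one, and
  it forces \<open>A_inner A (T x) x\<close> to vanish at vectors of seminorm \<open>0\<close>, which cannot be normalized.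
\<close>

lemma A_numerical_radius_upper:
  assumes T: "\<And>c x. T (c *\<^sub>C x) = c *\<^sub>C T x"
    and bound: "\<And>x. cmod (A_inner A (T x) x) \<le> k * (A_norm A x)\<^sup>2"
  shows "0 \<le> A_numerical_radius A T"
    and "cmod (A_inner A (T x) x) \<le> A_numerical_radius A T * (A_norm A x)\<^sup>2"
proof -
  let ?V = "insert 0 {cmod (A_inner A (T x) x) |x. A_norm A x = 1}"
  have "cmod (A_inner A (T x) x) \<le> max 0 k" if "A_norm A x = 1" for x
    using bound[of x] that by simp
  then have bdd: "bdd_above ?V"
    by (intro bdd_aboveI[of _ "max 0 k"]) auto
  then show "0 \<le> A_numerical_radius A T"
    unfolding A_numerical_radius_def by (intro cSup_upper) auto
  show "cmod (A_inner A (T x) x) \<le> A_numerical_radius A T * (A_norm A x)\<^sup>2"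
  proof (cases "A_norm A x = 0")
    case True
    then show ?thesis using bound[of x] by simp
  next
    case False
    define n where "n = A_norm A x"
    have n: "0 < n" using False A_norm_nonneg[of x] unfolding n_def by linarith
    let ?u = "complex_of_real (1 / n) *\<^sub>C x"
    have "A_norm A ?u = 1"
      using n by (simp add: A_norm_scaleC n_def norm_divide)
    then have "cmod (A_inner A (T ?u) ?u) \<le> A_numerical_radius A T"
      unfolding A_numerical_radius_def by (intro cSup_upper bdd) auto
    moreover have "cmod (A_inner A (T ?u) ?u) = cmod (A_inner A (T x) x) / n\<^sup>2"
      using n by (simp add: T A_inner_scaleC_left A_inner_scaleC_right norm_mult norm_divide
          power2_eq_square)
    ultimately show ?thesis
      using n unfolding n_def by (simp add: divide_le_eq)
  qed
qed

end

section \<open>The direct sum and the inequality\<close>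

lemma bounded_clinear_op_matrix_diag:
  assumes "bounded_clinear A"
  shows "bounded_clinear (op_matrix A (\<lambda>_. 0) (\<lambda>_. 0) A)"
proof -
  have "bounded_linear (\<lambda>z. (A (fst z), A (snd z)))"
    by (intro bounded_linear_Pair bounded_linear_compose[OF bounded_clinearD(1)[OF assms]]
        bounded_linear_fst bounded_linear_snd)
  moreover have "op_matrix A (\<lambda>_. 0) (\<lambda>_. 0) A = (\<lambda>z. (A (fst z), A (snd z)))"
    by (auto simp: op_matrix_def)
  ultimately show ?thesis
    by (simp add: bounded_clinear_def scaleC_prod_def bounded_clinearD(2)[OF assms])
qed

lemma A_inner_op_matrix_diag:
  "A_inner (op_matrix A (\<lambda>_. 0) (\<lambda>_. 0) A) (x1, x2) (y1, y2) = A_inner A x1 y1 + A_inner A x2 y2"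
  by (simp add: A_inner_def op_matrix_def cinner_prod_def)

lemma semi_hilbertian_op_matrix_diag:
  assumes "semi_hilbertian A"
  shows "semi_hilbertian (op_matrix A (\<lambda>_. 0) (\<lambda>_. 0) A)"
proof
  interpret semi_hilbertian A by fact
  have "cinner (op_matrix A (\<lambda>_. 0) (\<lambda>_. 0) A z) z \<in> \<real>\<^sub>\<ge>\<^sub>0" for z
    using positive unfolding positive_op_def
    by (cases z) (simp add: op_matrix_def cinner_prod_def nonneg_Reals_add_I)
  then show "positive_op (op_matrix A (\<lambda>_. 0) (\<lambda>_. 0) A)"
    unfolding positive_op_def
    using bounded_clinear_op_matrix_diag[OF bounded_clinear_A] by blast
qed

context semi_hilbertian
begin

lemma A_norm_op_matrix_diag:
  "(A_norm (op_matrix A (\<lambda>_. 0) (\<lambda>_. 0) A) (x, y))\<^sup>2 = (A_norm A x)\<^sup>2 + (A_norm A y)\<^sup>2"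
proof -
  interpret D: semi_hilbertian "op_matrix A (\<lambda>_. 0) (\<lambda>_. 0) A"
    by (rule semi_hilbertian_op_matrix_diag) unfold_locales
  have "complex_of_real ((A_norm (op_matrix A (\<lambda>_. 0) (\<lambda>_. 0) A) (x, y))\<^sup>2)
      = complex_of_real ((A_norm A x)\<^sup>2 + (A_norm A y)\<^sup>2)"
    unfolding D.A_inner_self[symmetric] A_inner_op_matrix_diag of_real_add A_inner_self ..
  then show ?thesis by (simp only: of_real_eq_iff)
qed

lemma op_matrix_row_numerical_bound:
  assumes P: "\<exists>c\<ge>0. \<forall>x. A_norm A (P x) \<le> c * A_norm A x"
    and Q: "\<exists>c\<ge>0. \<forall>x. A_norm A (Q x) \<le> c * A_norm A x"
  shows "\<exists>k. \<forall>z. cmod (A_inner (op_matrix A (\<lambda>_. 0) (\<lambda>_. 0) A)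
      (op_matrix P Q (\<lambda>_. 0) (\<lambda>_. 0) z) z)
    \<le> k * (A_norm (op_matrix A (\<lambda>_. 0) (\<lambda>_. 0) A) z)\<^sup>2"
proof -
  obtain c d where c: "0 \<le> c" "\<And>x. A_norm A (P x) \<le> c * A_norm A x"
    and d: "0 \<le> d" "\<And>x. A_norm A (Q x) \<le> d * A_norm A x"
    using P Q by blast
  have "cmod (A_inner A (P x + Q y) x) \<le> (c + d) * ((A_norm A x)\<^sup>2 + (A_norm A y)\<^sup>2)" for x y
  proof -
    define a b where "a = A_norm A x" and "b = A_norm A y"
    have "cmod (A_inner A (P x + Q y) x) \<le> cmod (A_inner A (P x) x) + cmod (A_inner A (Q y) x)"
      unfolding A_inner_add_left by (rule norm_triangle_ineq)
    also have "\<dots> \<le> (c * a) * a + (d * b) * a"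
      unfolding a_def b_def
      by (intro add_mono order_trans[OF A_cauchy_schwarz] mult_right_mono c d) simp_all
    also have "\<dots> = c * (a * a) + d * (b * a)"
      by simp
    also have "\<dots> \<le> c * (a\<^sup>2 + b\<^sup>2) + d * (a\<^sup>2 + b\<^sup>2)"
    proof (intro add_mono mult_left_mono c d)
      show "a * a \<le> a\<^sup>2 + b\<^sup>2" by (simp add: power2_eq_square)
      show "b * a \<le> a\<^sup>2 + b\<^sup>2"
      proof -
        have "0 \<le> b * a" by (simp add: a_def b_def)
        moreover have "2 * (b * a) \<le> a\<^sup>2 + b\<^sup>2"
          using sum_squares_bound[of a b] by (simp add: mult_ac)
        ultimately show ?thesis by linarith
      qed
    qed
    finally show ?thesis by (simp add: a_def b_def algebra_simps)
  qed
  then have "\<forall>z. cmod (A_inner (op_matrix A (\<lambda>_. 0) (\<lambda>_. 0) A)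
      (op_matrix P Q (\<lambda>_. 0) (\<lambda>_. 0) z) z)
    \<le> (c + d) * (A_norm (op_matrix A (\<lambda>_. 0) (\<lambda>_. 0) A) z)\<^sup>2"
  proof (intro allI, goal_cases)
    case (1 z)
    have "A_inner A 0 y = 0" for y
      using A_inner_scaleC_left[of 0 0 y] A_inner_add_left[of 0 0 y] by simp
    with 1 show ?case
      by (cases z) (simp add: op_matrix_def[of P] A_inner_op_matrix_diag A_norm_op_matrix_diag)
  qed
  then show ?thesis by blast
qed

text \<open>
  The two signs of the final inequality are the cases \<open>s = 1\<close> and \<open>s = - 1\<close>; a unimodular \<open>s\<close> does
  not change the modulus of the cross term.
\<close>

lemma A_op_norm_unimodular_combination:
  assumes P: "P \<in> A_adjointable A" and Q: "Q \<in> A_adjointable A" and s: "cmod s = 1"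
  defines "w \<equiv> A_numerical_radius (op_matrix A (\<lambda>_. 0) (\<lambda>_. 0) A) (op_matrix P Q (\<lambda>_. 0) (\<lambda>_. 0))"
    and "r \<equiv> A_numerical_radius A (P \<circ> A_sharp A Q)"
  shows "0 \<le> w" and "(A_op_norm A (\<lambda>x. P x + s *\<^sub>C Q x))\<^sup>2 \<le> 4 * w\<^sup>2 + 2 * r"
proof -
  let ?AA = "op_matrix A (\<lambda>_. 0) (\<lambda>_. 0) A" and ?T = "op_matrix P Q (\<lambda>_. 0) (\<lambda>_. 0)"
  let ?N = "A_norm A" and ?B = "A_inner A"
  interpret D: semi_hilbertian ?AA
    by (rule semi_hilbertian_op_matrix_diag) unfold_locales
  have bP: "bounded_clinear P" and bQ: "bounded_clinear Q"
    using P Q unfolding A_adjointable_def by auto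
  define P' Q' where "P' = A_sharp A P" and "Q' = A_sharp A Q"
  note P' = A_sharp_works[OF P, folded P'_def] and Q' = A_sharp_works[OF Q, folded Q'_def]
  note P'_adj = A_adjoint_flip[of P P', OF P'(2)] and Q'_adj = A_adjoint_flip[of Q Q', OF Q'(2)]
  have zero_left: "?B 0 y = 0" for y
    using A_inner_add_left[of 0 0 y] by simp

  have norm_0: "?N 0 = 0"
    by (simp add: A_norm_def zero_left)
  have T_add: "?T (x + y) = ?T x + ?T y" for x y
    by (cases x; cases y) (simp add: op_matrix_def bounded_clinearD[OF bP] bounded_clinearD[OF bQ])
  have scaleC_0: "c *\<^sub>C 0 = (0::'a)" for c
    using scaleC_add_right[of c 0 0] by simp
  have T_scaleC: "?T (c *\<^sub>C x) = c *\<^sub>C ?T x" for c x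
    by (cases x) (simp add: op_matrix_def scaleC_prod_def scaleC_add_right scaleC_0
        bounded_clinearD[OF bP] bounded_clinearD[OF bQ])
  obtain k where k: "\<And>z. cmod (A_inner ?AA (?T z) z) \<le> k * (A_norm ?AA z)\<^sup>2"
    using op_matrix_row_numerical_bound[of P Q] A_adjoint_pair_imp_A_bounded[OF bP P']
      A_adjoint_pair_imp_A_bounded[OF bQ Q'] by blast
  show w: "0 \<le> w"
    unfolding w_def by (rule D.A_numerical_radius_upper(1)[OF T_scaleC k])
  have T_bound: "cmod (A_inner ?AA (?T v) u) \<le> 2 * w * A_norm ?AA v * A_norm ?AA u" for u v
    using w unfolding w_def
    by (intro D.A_inner_le_numerical_bound T_add T_scaleC D.A_numerical_radius_upper(2)[OF T_scaleC k])
  \<comment> \<open>Pairing \<open>T (P' y, Q' y)\<close> with \<open>(y, 0)\<close> recovers the left side of this inequality.\<close>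
  have row: "(?N (P' y))\<^sup>2 + (?N (Q' y))\<^sup>2 \<le> 4 * w\<^sup>2 * (?N y)\<^sup>2" for y
  proof -
    let ?v = "(P' y, Q' y)"
    define n where "n = A_norm ?AA ?v"
    have n2: "n\<^sup>2 = (?N (P' y))\<^sup>2 + (?N (Q' y))\<^sup>2"
      unfolding n_def by (rule A_norm_op_matrix_diag)
    have "A_norm ?AA (y, 0) = ?N y"
      using A_norm_op_matrix_diag[of y 0] norm_0 by simp
    moreover have "A_inner ?AA (?T ?v) (y, 0) = of_real (n\<^sup>2)"
      unfolding n2 by (simp add: op_matrix_def[of P] A_inner_op_matrix_diag zero_left A_inner_add_left
          P'(2) Q'(2) A_inner_self norm_0)
    ultimately have "n\<^sup>2 \<le> 2 * w * n * ?N y"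
      using T_bound[of ?v "(y, 0)"] by (simp add: n_def[symmetric] del: of_real_power)
    then have *: "n * n \<le> (2 * w * ?N y) * n"
      by (simp add: power2_eq_square mult_ac)
    have "0 \<le> n" by (simp add: n_def)
    with * w have "n \<le> 2 * w * ?N y"
      by (cases "n = 0") auto
    then have "n\<^sup>2 \<le> (2 * w * ?N y)\<^sup>2"
      by (intro power_mono) (simp_all add: n_def)
    then show ?thesis
      by (simp add: n2 power_mult_distrib)
  qed
  have cross: "0 \<le> r" "cmod (?B (Q' y) (P' y)) \<le> r * (?N y)\<^sup>2" for y
  proof -
    obtain c d where c: "0 \<le> c" "\<And>x. ?N (P' x) \<le> c * ?N x"
      and d: "0 \<le> d" "\<And>x. ?N (Q' x) \<le> d * ?N x"
      using A_adjoint_pair_imp_A_bounded[OF P'(1) bP P'_adj]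
        A_adjoint_pair_imp_A_bounded[OF Q'(1) bQ Q'_adj] by blast
    have bound: "cmod (?B ((P \<circ> Q') x) x) \<le> (d * c) * (?N x)\<^sup>2" for x
    proof -
      have "cmod (?B ((P \<circ> Q') x) x) \<le> ?N (Q' x) * ?N (P' x)"
        unfolding comp_def P'(2) by (rule A_cauchy_schwarz)
      also have "\<dots> \<le> (d * ?N x) * (c * ?N x)"
        using c d by (intro mult_mono) auto
      finally show ?thesis by (simp add: power2_eq_square mult_ac)
    qed
    have hom: "(P \<circ> Q') (c *\<^sub>C x) = c *\<^sub>C (P \<circ> Q') x" for c x
      by (simp add: bounded_clinearD[OF bP] bounded_clinearD[OF Q'(1)])
    show "0 \<le> r"
      unfolding r_def Q'_def[symmetric] by (rule A_numerical_radius_upper(1)[OF hom bound])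
    show "cmod (?B (Q' y) (P' y)) \<le> r * (?N y)\<^sup>2"
      using A_numerical_radius_upper(2)[OF hom bound, of y]
      unfolding r_def Q'_def[symmetric] by (simp add: P'(2) comp_def)
  qed
  \<comment> \<open>It suffices to bound the \<open>A\<close>-adjoint of the combination by \<open>sqrt K\<close>.\<close>
  define K where "K = 4 * w\<^sup>2 + 2 * r"
  have K: "0 \<le> K" using cross(1) by (simp add: K_def)
  have R': "?N (P' y + cnj s *\<^sub>C Q' y) \<le> sqrt K * ?N y" for y
  proof (rule power2_le_imp_le)
    have "Re (?B (P' y) (cnj s *\<^sub>C Q' y)) \<le> cmod (?B (Q' y) (P' y))"
    proof -
      have "Re (?B (P' y) (cnj s *\<^sub>C Q' y)) \<le> cmod (?B (P' y) (cnj s *\<^sub>C Q' y))"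
        by (rule complex_Re_le_cmod)
      also have "\<dots> = cmod (?B (Q' y) (P' y))"
        using s by (subst A_inner_commute) (simp add: A_inner_scaleC_left norm_mult)
      finally show ?thesis .
    qed
    then have "(?N (P' y + cnj s *\<^sub>C Q' y))\<^sup>2 \<le> 4 * w\<^sup>2 * (?N y)\<^sup>2 + 2 * (r * (?N y)\<^sup>2)"
      using row[of y] cross(2)[of y] s by (simp add: A_norm_add_sq A_norm_scaleC)
    also have "\<dots> = (sqrt K * ?N y)\<^sup>2"
      using K by (simp add: power_mult_distrib) (simp add: K_def algebra_simps)
    finally show "(?N (P' y + cnj s *\<^sub>C Q' y))\<^sup>2 \<le> (sqrt K * ?N y)\<^sup>2" .
  qed (use K in simp)
  have "?B (P x + s *\<^sub>C Q x) y = ?B x (P' y + cnj s *\<^sub>C Q' y)" for x y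
    by (simp add: A_inner_add_left A_inner_add_right A_inner_scaleC_left A_inner_scaleC_right
        P'(2) Q'(2))
  from A_norm_bound_of_A_adjoint[OF this R']
  have "?N (P x + s *\<^sub>C Q x) \<le> sqrt K * ?N x" for x .
  from A_op_norm_le[OF _ this] have "0 \<le> A_op_norm A (\<lambda>x. P x + s *\<^sub>C Q x)"
    "A_op_norm A (\<lambda>x. P x + s *\<^sub>C Q x) \<le> sqrt K"
    using K by auto
  then have "(A_op_norm A (\<lambda>x. P x + s *\<^sub>C Q x))\<^sup>2 \<le> (sqrt K)\<^sup>2"
    by (intro power_mono)
  then show "(A_op_norm A (\<lambda>x. P x + s *\<^sub>C Q x))\<^sup>2 \<le> 4 * w\<^sup>2 + 2 * r"
    using K by (simp add: K_def)
qed

end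

theorem theorem2p7:
  fixes A P Q :: "'a::chilbert_space \<Rightarrow> 'a"
  assumes "positive_op A"
    and "P \<in> A_adjointable A"
    and "Q \<in> A_adjointable A"
  shows "A_numerical_radius (op_matrix A (\<lambda>_. 0) (\<lambda>_. 0) A) (op_matrix P Q (\<lambda>_. 0) (\<lambda>_. 0))
    \<ge> 1 / 2 * sqrt (max ((A_op_norm A (\<lambda>x. P x + Q x))\<^sup>2) ((A_op_norm A (\<lambda>x. P x - Q x))\<^sup>2)
                    - 2 * A_numerical_radius A (P \<circ> A_sharp A Q))"
proof -
  interpret semi_hilbertian A
    using assms(1) by unfold_locales
  let ?w = "A_numerical_radius (op_matrix A (\<lambda>_. 0) (\<lambda>_. 0) A) (op_matrix P Q (\<lambda>_. 0) (\<lambda>_. 0))"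
  let ?r = "A_numerical_radius A (P \<circ> A_sharp A Q)"
  note comb = A_op_norm_unimodular_combination[OF assms(2,3)]
  have one: "1 *\<^sub>C x = x" and minus: "(- 1) *\<^sub>C x = - x" for x :: 'a
    using scaleR_scaleC[of 1 x] scaleR_scaleC[of "- 1" x] by simp_all
  have "max ((A_op_norm A (\<lambda>x. P x + Q x))\<^sup>2) ((A_op_norm A (\<lambda>x. P x - Q x))\<^sup>2) - 2 * ?r
      \<le> (2 * ?w)\<^sup>2"
    using comb(2)[of 1] comb(2)[of "- 1"] by (simp add: one minus)
  then have "sqrt (max ((A_op_norm A (\<lambda>x. P x + Q x))\<^sup>2) ((A_op_norm A (\<lambda>x. P x - Q x))\<^sup>2) - 2 * ?r)
      \<le> sqrt ((2 * ?w)\<^sup>2)"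
    by (rule real_sqrt_le_mono)
  also have "\<dots> = 2 * ?w"
    using comb(1)[of 1] by (intro real_sqrt_unique) simp_all
  finally show ?thesis by simp
qed

end
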